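(* Let $f$ be strongly smooth with constant $L>0$. Let $\{x^k\}$ be the (infinite) sequence generated by Algorithm BNL0R (described in the context) with $\tau\in(0,\overline{\tau})$ and $\delta\in(0,\min\{1,2L\})$. Let $x^*$ be any limit point of $\{x^k\}$, and suppose that strict complementarity and Abadie's constraint qualification hold at $x^*$. Then: (i) There exists a subsequence $\{x^{k_t}\}$ of $\{x^k\}$ (converging to $x^*$) and sets $\Theta_\infty$, $\Gamma_\infty$ such that $\Theta_{k_t}\equiv\Theta_\infty$ and $\Gamma_{k_t}\equiv\Gamma_\infty$ for all sufficiently large $k_t$. (ii) The limit point $x^*$ satisfies $$\nabla_{\Theta_\infty}f(x^* )=0,\qquad d^*_{\Gamma_\infty}=0,\qquad x^*_{\overline{\mathcal I}_\infty}=0,\qquad \mathrm{supp}(x^* )\subseteq\mathcal I_\infty,$$ where $d^*_{\Gamma_\infty}:=[\Pi_\Omega(x^*-\tau\nabla f(x^* ))]_{\Gamma_\infty}-x^*_{\Gamma_\infty}$. With $\Gamma^u_\infty:=\Gamma^u_{k_t}$ and $\Gamma^l_\infty:=\Gamma^l_{k_t}$ (for sufficiently large $k_t$), one has $x^*_{\Gamma^u_\infty}=u_{\Gamma^u_\infty}$ and $x^*_{\Gamma^l_\infty}=-l_{\Gamma^l_\infty}$. Moreover $x^*\ne0$ and $x^*\in\Omega$. Furthermore, if $\tau_*$ satisfies $$0<\tau_*<\min\Big\{\overline{\tau},\ \min_{i\in\mathrm{supp}(x^* )}\frac{|x_i^*|^2}{2\lambda},\ \frac{2\lambda}{b^2}\Big\},\qquad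 b:=\max\Big\{\max_{i\in\overline{\mathrm{supp}(x^* )}}|\nabla_if(x^* )|,\,1\Big\},$$ then $x^*$ is a $\tau_*$-stationary point. (iii) If $x^*$ is an isolated limit point of $\{x^k\}$, then $x^k\to x^*$.
   Context: Problem. $f:\mathbb{R}^n\to\mathbb{R}$ is twice continuously differentiable and bounded from below, $\lambda>0$, $l,u\in\mathbb{R}^n_+$, $\Omega:=\{x\in\mathbb{R}^n: -l\le x\le u\}$, $\|x\|_0$ is the number of nonzero entries of $x$, and $p(x):=\|x\|_0+\delta_\Omega(x)$, where $\delta_\Omega$ is $0$ on $\Omega$ and $+\infty$ outside. The problem is $\min_{x} f(x)+\lambda p(x)$. It is assumed throughout that $\nabla f(0)\neq 0$. For $t>0$, $x$ is a $t$-stationary point if $x\in\mathrm{Prox}_{t\lambda p(\cdot)}(x-t\nabla f(x)):=\arg\min_{y\in\mathbb{R}^n}\frac12\|y-(x-t\nabla f(x))\|^2+t\lambda p(y)$. Notation. $\mathbb{N}_n=\{1,\dots,n\}$; $\overline{\mathcal I}$ is the complement of $\mathcal I$ in $\mathbb{N}_n$; $x_{\mathcal I}$, $\nabla_{\mathcal I}f$, $\nabla^2_{\Theta,\Gamma}f$ are subvectors/submatrices; $\|\cdot\|$ is the $\ell_2$ norm; $\Pi_\Omega$ is the Euclidean projection onto $\Omega$; $\mathrm{supp}(x)$ is the set of indices of nonzero entries of $x$. A maximum over the empty set is disregarded. $f$ is strongly smooth with constant $L>0$ if $f(z)\le f(x)+\langle\nabla f(x),z-x\rangle+\frac L2\|z-x\|^2$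 for all $x,z\in\mathbb{R}^n$. Parameters. $\sigma\in(0,1/2)$, $\beta\in(0,1)$, $\delta>0$, $a:=\min_{i}\min(l_i^2,u_i^2)$, $\tau>0$ with $\tau<a/(2\lambda)$, and $\lambda\in(0,\underline{\lambda})$, where $\underline{\lambda}:=\min_i\{\frac{\tau}{2}|\nabla_if(0)|^2:\nabla_if(0)\ne0\}$. Moreover $$\overline{\alpha}:=\min\Big\{\tfrac{1-2\sigma}{L/\delta-\sigma},\tfrac{2(1-\sigma)\delta}{L},1\Big\},\qquad \overline{\tau}:=\min\Big\{\tfrac{2\overline{\alpha}\delta\beta}{nL^2},\tfrac{\overline{\alpha}\beta}{n},\tfrac1{4L},\tfrac{2(1-\sigma)}{L},\tfrac{a}{2\lambda},\tfrac{a}{2\max_{i\in\mathbb{N}_n}|\nabla_if(0)|}\Big\}.$$ Index sets. For $x\in\mathbb{R}^n$: $\Theta_\tau(x)=\{i: -l_i<x_i-\tau\nabla_if(x)<u_i,\ |x_i-\tau\nabla_if(x)|\ge\sqrt{2\tau\lambda}\}$, $\Gamma^u_\tau(x)=\{i: x_i-\tau\nabla_if(x)\ge u_i\}$, $\Gamma^l_\tau(x)=\{i:x_i-\tau\nabla_if(x)\le -l_i\}$, $\Gamma_\tau(x)=\Gamma^u_\tau(x)\cup\Gamma^l_\tau(x)$, $\mathcal I_\tau(x)=\Theta_\tau(x)\cup\Gamma_\tau(x)$. At iterate $x^k$ write $\Theta_k=\Theta_\tau(x^k)$, $\Gamma_k=\Gamma_\tau(x^k)$, $\Gamma^u_k=\Gamma^u_\tau(x^k)$,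 $\Gamma^l_k=\Gamma^l_\tau(x^k)$, $\mathcal I_k=\mathcal I_\tau(x^k)$, $g^k=\nabla f(x^k)$. Algorithm BNL0R. Start with $x^0\in\Omega$, $\mathcal I_{-1}=\emptyset$, $k=0$. (Termination tests are ignored, so an infinite sequence is produced.) S1. Compute $\Theta_k,\Gamma_k,\mathcal I_k$. S2. (NM) If the Newton system $$\nabla^2_{\Theta_k,\Theta_k}f(x^k)d^k_{\Theta_k}+\nabla^2_{\Theta_k,\Gamma_k}f(x^k)d^k_{\Gamma_k}+\nabla^2_{\Theta_k,\overline{\mathcal I}_k}f(x^k)d^k_{\overline{\mathcal I}_k}=-\nabla_{\Theta_k}f(x^k),$$ $$d^k_{\Gamma_k}=[\Pi_\Omega(x^k-\tau g^k)]_{\Gamma_k}-x^k_{\Gamma_k},\qquad d^k_{\overline{\mathcal I}_k}=-x^k_{\overline{\mathcal I}_k}$$ is solvable and its solution $d^k$ satisfies all of: $\langle g^k_{\mathcal I_k},d^k_{\mathcal I_k}\rangle\le-\delta\|d^k\|^2+\|x^k_{\overline{\mathcal I}_k}\|^2/(4\tau)$; $|\mathcal I_k|\le\|x^k\|_0$; $x^k+d^k\in\Omega$; and ($\Theta_k\setminus\mathcal I_{k-1}\ne\emptyset$ or $\mathcal I_k=\mathcal I_{k-1}$); then use this $d^k$ and go to S3. (PGM) Otherwise set $d^k_{\mathcal I_k}=[\Pi_\Omega(x^k-\tau g^k)]_{\mathcal I_k}-x^k_{\mathcal I_k}$, $d^k_{\overline{\mathcal I}_k}=-x^k_{\overline{\mathcal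 I}_k}$, $x^{k+1}=x^k+d^k$, and go to S4. S3. Let $\tilde x^k(\alpha)$ be the vector with $\tilde x^k(\alpha)_{\Theta_k}=x^k_{\Theta_k}+\alpha d^k_{\Theta_k}$, $\tilde x^k(\alpha)_{\Gamma_k}=x^k_{\Gamma_k}+d^k_{\Gamma_k}$, $\tilde x^k(\alpha)_{\overline{\mathcal I}_k}=0$. Find the smallest integer $m_k\ge0$ with $f(\tilde x^k(\beta^{m_k}))\le f(x^k)+\sigma\beta^{m_k}\langle g^k,d^k\rangle$; set $\alpha_k=\beta^{m_k}$, $x^{k+1}=\tilde x^k(\alpha_k)$. S4. $k\leftarrow k+1$; go to S1. In this setting the sets $\mathcal I_k$ are constant for all sufficiently large $k$; $\mathcal I_\infty$ denotes this constant value, so $\mathcal I_\infty=\Theta_\infty\cup\Gamma_\infty$. Strict complementarity and Abadie's CQ at $x^*$ refer to the problem $\min f(x)$ s.t. $-l_i\le x_i\le u_i$ ($i\in\mathcal I_\infty$), $x_i=0$ ($i\notin\mathcal I_\infty$). With KKT multipliers $\xi_i\ge0$ for $x_i\le u_i$, $\beta_i\ge0$ for $-l_i\le x_i$ ($i\in\mathcal I_\infty$) and $\nu_i\in\mathbb R$ for $x_i=0$ ($i\notin\mathcal I_\infty$), satisfying $\nabla f(x^* )+\xi-\beta+\nu=0$ and complementary slackness, strict complementarity means $\xi_i>0$ whenever $x_i^*=u_i$ and $\beta_i>0$ whenever $x_i^*=-l_i$, $i\in\mathcal I_\infty$. Abadie's CQ means that the tangent cone of the feasible set at $x^*$ equals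 the linearized cone at $x^*$. *)

theory Defs
  imports "HOL-Analysis.Analysis"
begin

definition twice_cont_diff ::
  "(real^'n \<Rightarrow> real) \<Rightarrow> (real^'n \<Rightarrow> real^'n) \<Rightarrow> (real^'n \<Rightarrow> real^'n^'n) \<Rightarrow> bool" where
  "twice_cont_diff f G H \<longleftrightarrow>
     (\<forall>x. GDERIV f x :> G x) \<and>
     (\<forall>x. (G has_derivative (\<lambda>h. H x *v h)) (at x)) \<and>
     continuous_on UNIV H"

definition strongly_smooth :: "real \<Rightarrow> (real^'n \<Rightarrow> real) \<Rightarrow> (real^'n \<Rightarrow> real^'n) \<Rightarrow> bool" where
  "strongly_smooth L f G \<longleftrightarrow>
     (\<forall>x z. f z \<le> f x + G x \<bullet> (z - x) + L / 2 * (norm (z - x))\<^sup>2)"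

definition supp :: "real^'n \<Rightarrow> 'n set" where
  "supp x = {i. x $ i \<noteq> 0}"

abbreviation l0 :: "real^'n \<Rightarrow> nat" where
  "l0 x \<equiv> card (supp x)"

abbreviation Omega :: "real^'n \<Rightarrow> real^'n \<Rightarrow> (real^'n) set" where
  "Omega l u \<equiv> cbox (- l) u"

text \<open>The projection onto \<open>Omega l u\<close> is \<^const>\<open>closest_point\<close>, which is well defined
  because the box is closed, convex and (as \<open>l\<close> and \<open>u\<close> are nonnegative) nonempty.\<close>

abbreviation proj :: "real^'n \<Rightarrow> real^'n \<Rightarrow> real^'n \<Rightarrow> real^'n" where
  "proj l u \<equiv> closest_point (Omega l u)"

definition l0_box :: "real^'n \<Rightarrow> real^'n \<Rightarrow> real^'n \<Rightarrow> ereal" where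
  "l0_box l u x = ereal (real (l0 x)) + (if x \<in> Omega l u then 0 else \<infinity>)"

definition Prox :: "(real^'n \<Rightarrow> ereal) \<Rightarrow> real^'n \<Rightarrow> (real^'n) set" where
  "Prox h w = {y. is_arg_min (\<lambda>z. ereal (1 / 2 * (norm (z - w))\<^sup>2) + h z) (\<lambda>z. True) y}"

definition stationary_point ::
  "real^'n \<Rightarrow> real^'n \<Rightarrow> real \<Rightarrow> (real^'n \<Rightarrow> real^'n) \<Rightarrow> real \<Rightarrow> real^'n \<Rightarrow> bool" where
  "stationary_point l u lam G t x \<longleftrightarrow>
     x \<in> Prox (\<lambda>y. ereal (t * lam) * l0_box l u y) (x - t *\<^sub>R G x)"

definition a_const :: "real^'n \<Rightarrow> real^'n \<Rightarrow> real" where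
  "a_const l u = Min (range (\<lambda>i. min ((l $ i)\<^sup>2) ((u $ i)\<^sup>2)))"

definition lam_upper :: "(real^'n \<Rightarrow> real^'n) \<Rightarrow> real \<Rightarrow> real" where
  "lam_upper G \<tau> = Min ((\<lambda>i. \<tau> / 2 * \<bar>G 0 $ i\<bar>\<^sup>2) ` {i. G 0 $ i \<noteq> 0})"

definition alpha_bar :: "real \<Rightarrow> real \<Rightarrow> real \<Rightarrow> real" where
  "alpha_bar \<sigma> \<delta> L =
     Min {(1 - 2 * \<sigma>) / (L / \<delta> - \<sigma>), 2 * (1 - \<sigma>) * \<delta> / L, 1}"

definition tau_bar ::
  "real^'n \<Rightarrow> real^'n \<Rightarrow> real \<Rightarrow> (real^'n \<Rightarrow> real^'n) \<Rightarrow> real \<Rightarrow> real \<Rightarrow> real \<Rightarrow> real \<Rightarrow> real" where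
  "tau_bar l u lam G \<sigma> \<beta> \<delta> L =
     Min {2 * alpha_bar \<sigma> \<delta> L * \<delta> * \<beta> / (real CARD('n) * L\<^sup>2),
          alpha_bar \<sigma> \<delta> L * \<beta> / real CARD('n),
          1 / (4 * L),
          2 * (1 - \<sigma>) / L,
          a_const l u / (2 * lam),
          a_const l u / (2 * Max (range (\<lambda>i. \<bar>G 0 $ i\<bar>)))}"

text \<open>The bound on \<open>\<tau>\<^sub>*\<close>; a minimum or maximum over an empty index set is disregarded.\<close>

definition b_const :: "(real^'n \<Rightarrow> real^'n) \<Rightarrow> real^'n \<Rightarrow> real" where
  "b_const G x = Max (insert 1 ((\<lambda>i. \<bar>G x $ i\<bar>) ` (- supp x)))"

definition tau_star_bound ::
  "real^'n \<Rightarrow> real^'n \<Rightarrow> real \<Rightarrow> (real^'n \<Rightarrow> real^'n) \<Rightarrow> real \<Rightarrow> real \<Rightarrow> real \<Rightarrow> real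
    \<Rightarrow> real^'n \<Rightarrow> real" where
  "tau_star_bound l u lam G \<sigma> \<beta> \<delta> L x =
     Min ({tau_bar l u lam G \<sigma> \<beta> \<delta> L, 2 * lam / (b_const G x)\<^sup>2}
          \<union> (\<lambda>i. \<bar>x $ i\<bar>\<^sup>2 / (2 * lam)) ` supp x)"

definition Theta ::
  "real^'n \<Rightarrow> real^'n \<Rightarrow> real \<Rightarrow> (real^'n \<Rightarrow> real^'n) \<Rightarrow> real \<Rightarrow> real^'n \<Rightarrow> 'n set" where
  "Theta l u lam G \<tau> x =
     {i. - (l $ i) < x $ i - \<tau> * G x $ i \<and> x $ i - \<tau> * G x $ i < u $ i \<and>
         \<bar>x $ i - \<tau> * G x $ i\<bar> \<ge> sqrt (2 * \<tau> * lam)}"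

definition Gamma_u ::
  "real^'n \<Rightarrow> (real^'n \<Rightarrow> real^'n) \<Rightarrow> real \<Rightarrow> real^'n \<Rightarrow> 'n set" where
  "Gamma_u u G \<tau> x = {i. x $ i - \<tau> * G x $ i \<ge> u $ i}"

definition Gamma_l ::
  "real^'n \<Rightarrow> (real^'n \<Rightarrow> real^'n) \<Rightarrow> real \<Rightarrow> real^'n \<Rightarrow> 'n set" where
  "Gamma_l l G \<tau> x = {i. x $ i - \<tau> * G x $ i \<le> - (l $ i)}"

definition Gamma_ul ::
  "real^'n \<Rightarrow> real^'n \<Rightarrow> (real^'n \<Rightarrow> real^'n) \<Rightarrow> real \<Rightarrow> real^'n \<Rightarrow> 'n set" where
  "Gamma_ul l u G \<tau> x = Gamma_u u G \<tau> x \<union> Gamma_l l G \<tau> x"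

definition Iset ::
  "real^'n \<Rightarrow> real^'n \<Rightarrow> real \<Rightarrow> (real^'n \<Rightarrow> real^'n) \<Rightarrow> real \<Rightarrow> real^'n \<Rightarrow> 'n set" where
  "Iset l u lam G \<tau> x = Theta l u lam G \<tau> x \<union> Gamma_ul l u G \<tau> x"

definition newton_direction ::
  "real^'n \<Rightarrow> real^'n \<Rightarrow> real \<Rightarrow> (real^'n \<Rightarrow> real^'n) \<Rightarrow> (real^'n \<Rightarrow> real^'n^'n) \<Rightarrow> real
    \<Rightarrow> real^'n \<Rightarrow> real^'n \<Rightarrow> bool" where
  "newton_direction l u lam G H \<tau> x d \<longleftrightarrow>
     (let Th = Theta l u lam G \<tau> x; Ga = Gamma_ul l u G \<tau> x; I = Iset l u lam G \<tau> x in
       (\<forall>i\<in>Th. (\<Sum>j\<in>Th. H x $ i $ j * d $ j) + (\<Sum>j\<in>Ga. H x $ i $ j * d $ j)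
                 + (\<Sum>j\<in>- I. H x $ i $ j * d $ j) = - (G x $ i)) \<and>
       (\<forall>i\<in>Ga. d $ i = proj l u (x - \<tau> *\<^sub>R G x) $ i - x $ i) \<and>
       (\<forall>i\<in>- I. d $ i = - (x $ i)))"

text \<open>Below, \<open>Iprev\<close> is the index set of the previous iteration.\<close>

definition newton_acceptable ::
  "real^'n \<Rightarrow> real^'n \<Rightarrow> real \<Rightarrow> (real^'n \<Rightarrow> real^'n) \<Rightarrow> real \<Rightarrow> real \<Rightarrow> 'n set
    \<Rightarrow> real^'n \<Rightarrow> real^'n \<Rightarrow> bool" where
  "newton_acceptable l u lam G \<tau> \<delta> Iprev x d \<longleftrightarrow>
     (let I = Iset l u lam G \<tau> x in
       (\<Sum>i\<in>I. G x $ i * d $ i) \<le> - \<delta> * (norm d)\<^sup>2 + (\<Sum>i\<in>- I. (x $ i)\<^sup>2) / (4 * \<tau>) \<and>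
       card I \<le> l0 x \<and>
       x + d \<in> Omega l u \<and>
       (Theta l u lam G \<tau> x - Iprev \<noteq> {} \<or> I = Iprev))"

definition trial_point ::
  "real^'n \<Rightarrow> real^'n \<Rightarrow> real \<Rightarrow> (real^'n \<Rightarrow> real^'n) \<Rightarrow> real \<Rightarrow> real^'n \<Rightarrow> real^'n
    \<Rightarrow> real \<Rightarrow> real^'n" where
  "trial_point l u lam G \<tau> x d \<alpha> =
     (\<chi> i. if i \<in> Theta l u lam G \<tau> x then x $ i + \<alpha> * d $ i
           else if i \<in> Gamma_ul l u G \<tau> x then x $ i + d $ i
           else 0)"

definition armijo ::
  "(real^'n \<Rightarrow> real) \<Rightarrow> real^'n \<Rightarrow> real^'n \<Rightarrow> real \<Rightarrow> (real^'n \<Rightarrow> real^'n) \<Rightarrow> real \<Rightarrow> real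
    \<Rightarrow> real^'n \<Rightarrow> real^'n \<Rightarrow> real \<Rightarrow> bool" where
  "armijo f l u lam G \<tau> \<sigma> x d \<alpha> \<longleftrightarrow>
     f (trial_point l u lam G \<tau> x d \<alpha>) \<le> f x + \<sigma> * \<alpha> * (G x \<bullet> d)"

definition newton_step ::
  "(real^'n \<Rightarrow> real) \<Rightarrow> real^'n \<Rightarrow> real^'n \<Rightarrow> real \<Rightarrow> (real^'n \<Rightarrow> real^'n) \<Rightarrow> real \<Rightarrow> real \<Rightarrow> real
    \<Rightarrow> real^'n \<Rightarrow> real^'n \<Rightarrow> real^'n \<Rightarrow> bool" where
  "newton_step f l u lam G \<tau> \<sigma> \<beta> x d x' \<longleftrightarrow>
     (\<exists>m::nat. armijo f l u lam G \<tau> \<sigma> x d (\<beta> ^ m) \<and>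
               (\<forall>j<m. \<not> armijo f l u lam G \<tau> \<sigma> x d (\<beta> ^ j)) \<and>
               x' = trial_point l u lam G \<tau> x d (\<beta> ^ m))"

definition pgm_direction ::
  "real^'n \<Rightarrow> real^'n \<Rightarrow> real \<Rightarrow> (real^'n \<Rightarrow> real^'n) \<Rightarrow> real \<Rightarrow> real^'n \<Rightarrow> real^'n" where
  "pgm_direction l u lam G \<tau> x =
     (\<chi> i. if i \<in> Iset l u lam G \<tau> x then proj l u (x - \<tau> *\<^sub>R G x) $ i - x $ i else - (x $ i))"

text \<open>One iteration. A singular Newton system may have several solutions; the algorithm tests
  the one that has been computed, and no assumption is made on which one this is.\<close>

definition bnl0r_step ::
  "(real^'n \<Rightarrow> real) \<Rightarrow> (real^'n \<Rightarrow> real^'n) \<Rightarrow> (real^'n \<Rightarrow> real^'n^'n) \<Rightarrow> real^'n \<Rightarrow> real^'n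
    \<Rightarrow> real \<Rightarrow> real \<Rightarrow> real \<Rightarrow> real \<Rightarrow> real \<Rightarrow> 'n set \<Rightarrow> real^'n \<Rightarrow> real^'n \<Rightarrow> bool" where
  "bnl0r_step f G H l u lam \<tau> \<sigma> \<beta> \<delta> Iprev x x' \<longleftrightarrow>
     (\<exists>d. newton_direction l u lam G H \<tau> x d \<and> newton_acceptable l u lam G \<tau> \<delta> Iprev x d \<and>
          newton_step f l u lam G \<tau> \<sigma> \<beta> x d x') \<or>
     ((\<not> (\<exists>d. newton_direction l u lam G H \<tau> x d) \<or>
       (\<exists>d. newton_direction l u lam G H \<tau> x d \<and> \<not> newton_acceptable l u lam G \<tau> \<delta> Iprev x d)) \<and>
      x' = x + pgm_direction l u lam G \<tau> x)"

definition bnl0r_sequence ::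
  "(real^'n \<Rightarrow> real) \<Rightarrow> (real^'n \<Rightarrow> real^'n) \<Rightarrow> (real^'n \<Rightarrow> real^'n^'n) \<Rightarrow> real^'n \<Rightarrow> real^'n
    \<Rightarrow> real \<Rightarrow> real \<Rightarrow> real \<Rightarrow> real \<Rightarrow> real \<Rightarrow> (nat \<Rightarrow> real^'n) \<Rightarrow> bool" where
  "bnl0r_sequence f G H l u lam \<tau> \<sigma> \<beta> \<delta> x \<longleftrightarrow>
     x 0 \<in> Omega l u \<and>
     (\<forall>k. bnl0r_step f G H l u lam \<tau> \<sigma> \<beta> \<delta>
            (case k of 0 \<Rightarrow> {} | Suc j \<Rightarrow> Iset l u lam G \<tau> (x j)) (x k) (x (Suc k)))"

definition limit_points :: "(nat \<Rightarrow> 'a::topological_space) \<Rightarrow> 'a set" where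
  "limit_points x = {y. \<exists>r::nat \<Rightarrow> nat. strict_mono r \<and> (x \<circ> r) \<longlonglongrightarrow> y}"

text \<open>The problem is to minimize \<open>f\<close> over \<open>feasible_set l u I\<close>.\<close>

definition feasible_set :: "real^'n \<Rightarrow> real^'n \<Rightarrow> 'n set \<Rightarrow> (real^'n) set" where
  "feasible_set l u I = {x. (\<forall>i\<in>I. - (l $ i) \<le> x $ i \<and> x $ i \<le> u $ i) \<and> (\<forall>i\<in>- I. x $ i = 0)}"

text \<open>The multipliers \<open>\<xi>\<close>, \<open>\<eta>\<close> of the bounds \<open>x\<^sub>i \<le> u\<^sub>i\<close>, \<open>- l\<^sub>i \<le> x\<^sub>i\<close> are indexed by \<open>I\<close> and
  the multiplier \<open>\<nu>\<close> of \<open>x\<^sub>i = 0\<close> by the complement of \<open>I\<close>; they are padded with zeros.\<close>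

definition kkt_multipliers ::
  "real^'n \<Rightarrow> real^'n \<Rightarrow> (real^'n \<Rightarrow> real^'n) \<Rightarrow> 'n set \<Rightarrow> real^'n
    \<Rightarrow> real^'n \<Rightarrow> real^'n \<Rightarrow> real^'n \<Rightarrow> bool" where
  "kkt_multipliers l u G I x \<xi> \<eta> \<nu> \<longleftrightarrow>
     x \<in> feasible_set l u I \<and>
     (\<forall>i\<in>I. \<xi> $ i \<ge> 0 \<and> \<eta> $ i \<ge> 0 \<and> \<nu> $ i = 0) \<and>
     (\<forall>i\<in>- I. \<xi> $ i = 0 \<and> \<eta> $ i = 0) \<and>
     G x + \<xi> - \<eta> + \<nu> = 0 \<and>
     (\<forall>i\<in>I. \<xi> $ i * (x $ i - u $ i) = 0 \<and> \<eta> $ i * (- (l $ i) - x $ i) = 0)"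

definition strict_complementarity ::
  "real^'n \<Rightarrow> real^'n \<Rightarrow> (real^'n \<Rightarrow> real^'n) \<Rightarrow> 'n set \<Rightarrow> real^'n \<Rightarrow> bool" where
  "strict_complementarity l u G I x \<longleftrightarrow>
     (\<exists>\<xi> \<eta> \<nu>. kkt_multipliers l u G I x \<xi> \<eta> \<nu> \<and>
        (\<forall>i\<in>I. (x $ i = u $ i \<longrightarrow> \<xi> $ i > 0) \<and> (x $ i = - (l $ i) \<longrightarrow> \<eta> $ i > 0)))"

definition tangent_cone :: "'a::real_normed_vector set \<Rightarrow> 'a \<Rightarrow> 'a set" where
  "tangent_cone S x =
     {d. \<exists>(y :: nat \<Rightarrow> 'a) (t :: nat \<Rightarrow> real).
           (\<forall>k. y k \<in> S) \<and> y \<longlonglongrightarrow> x \<and> (\<forall>k. t k > 0) \<and> t \<longlonglongrightarrow> 0 \<and>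
           (\<lambda>k. (y k - x) /\<^sub>R t k) \<longlonglongrightarrow> d}"

definition linearized_cone :: "real^'n \<Rightarrow> real^'n \<Rightarrow> 'n set \<Rightarrow> real^'n \<Rightarrow> (real^'n) set" where
  "linearized_cone l u I x =
     {d. (\<forall>i\<in>I. (x $ i = u $ i \<longrightarrow> d $ i \<le> 0) \<and> (x $ i = - (l $ i) \<longrightarrow> - (d $ i) \<le> 0)) \<and>
         (\<forall>i\<in>- I. d $ i = 0)}"

definition abadie_cq :: "real^'n \<Rightarrow> real^'n \<Rightarrow> 'n set \<Rightarrow> real^'n \<Rightarrow> bool" where
  "abadie_cq l u I x \<longleftrightarrow> tangent_cone (feasible_set l u I) x = linearized_cone l u I x"

end

theory Submission
  imports Defs
begin

text \<open>Once the index set \<open>I\<^sub>k\<close> is constant, the iterates vanish outside it. Newton directions are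
  then descent directions, and strong smoothness together with \<open>\<tau> < 1 / (4 L)\<close> makes the Armijo
  condition hold for all step sizes up to \<open>min 1 (2 (1 - \<sigma>) \<delta> / L)\<close>, so backtracking keeps the step
  sizes bounded away from 0. Hence both kinds of steps decrease \<open>f\<close> by a fixed multiple of
  \<open>\<parallel>d\<^sup>k\<parallel>\<^sup>2\<close>, and \<open>d\<^sup>k\<close> tends to 0. Along a subsequence with constant \<open>\<Theta>\<close> and \<open>\<Gamma>\<close>, the
  Newton system (or the projected gradient step) forces the gradient on \<open>\<Theta>\<close> and the projection
  residual on \<open>\<Gamma>\<close> to 0 in the limit. Every \<open>i\<close> in the limiting index set has
  \<open>xs $ i \<noteq> 0\<close>, so \<open>xs = 0\<close> would make that set empty and the iterates eventually 0,
  contrary to the choice of \<open>\<lambda>\<close>.\<close>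

section \<open>Projection onto the box, coordinate by coordinate\<close>

text \<open>The clamped vector lies in the box and is, in each coordinate, at least as close to
  \<open>w\<close> as any point of the box; the closest point of a closed convex set is
  unique.\<close>

lemma proj_nth:
  fixes l u w :: "real^'n"
  assumes "\<forall>i. 0 \<le> l $ i" "\<forall>i. 0 \<le> u $ i"
  shows "proj l u w $ i = max (- (l $ i)) (min (u $ i) (w $ i))"
proof -
  let ?p = "(\<chi> i. max (- (l $ i)) (min (u $ i) (w $ i))) :: real^'n"
  have "?p = proj l u w"
  proof (rule closest_point_unique)
    show "?p \<in> Omega l u"
      using assms by (auto simp: mem_box_cart intro: order_trans[of _ 0])
    show "\<forall>z\<in>Omega l u. dist w ?p \<le> dist w z"
    proof
      fix z assume z: "z \<in> Omega l u"
      show "dist w ?p \<le> dist w z"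
        unfolding dist_norm
      proof (rule norm_le_componentwise_cart)
        fix i
        show "norm ((w - ?p) $ i) \<le> norm ((w - z) $ i)"
          using z assms by (auto simp: mem_box_cart max_def min_def) (smt (verit))+
      qed
    qed
  qed (auto simp: convex_box)
  then show ?thesis
    by (metis (no_types, lifting) vec_lambda_beta)
qed

text \<open>This is the variational inequality of the projection onto an interval: the clamped step
  has the sign of \<open>- \<tau> * g\<close> and is no longer, so
  \<open>d * (d + \<tau> * g)\<close> cannot be positive.\<close>

lemma clamped_step_descent:
  fixes x g \<tau> lo hi :: real
  assumes "0 < \<tau>" "lo \<le> x" "x \<le> hi" "d = max lo (min hi (x - \<tau> * g)) - x"
  shows "\<tau> * (g * d) \<le> - d\<^sup>2"
proof -
  consider "d = - \<tau> * g" | "0 \<le> d" "d \<le> - \<tau> * g" | "d \<le> 0" "- \<tau> * g \<le> d"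
    using assms by (auto simp: max_def min_def split: if_splits)
  then have "d * (d + \<tau> * g) \<le> 0"
    by cases (auto simp: mult_le_0_iff)
  then show ?thesis
    by (simp add: algebra_simps power2_eq_square)
qed

lemma norm_vec_square: "(norm (v :: real^'n))\<^sup>2 = (\<Sum>i\<in>UNIV. (v $ i)\<^sup>2)"
  by (simp only: power2_norm_eq_inner) (simp add: inner_vec_def power2_eq_square)

text \<open>From \<open>K\<close> on, \<open>a\<close> is nonincreasing and bounded below, hence
  convergent, and \<open>e\<close> is squeezed between 0 and the differences of consecutive
  terms.\<close>

lemma sufficient_decrease_tendsto_zero:
  fixes a e :: "nat \<Rightarrow> real"
  assumes decr: "\<And>k. K \<le> k \<Longrightarrow> a (Suc k) \<le> a k - e k"
    and e: "\<And>k. K \<le> k \<Longrightarrow> 0 \<le> e k" and bd: "\<And>k. B \<le> a k"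
  shows "e \<longlonglongrightarrow> 0"
proof -
  have "a (Suc k + K) \<le> a (k + K)" for k
    using decr[of "k + K"] e[of "k + K"] by simp
  then have "decseq (\<lambda>k. a (k + K))"
    by (simp add: decseq_Suc_iff)
  then obtain A where A: "(\<lambda>k. a (k + K)) \<longlonglongrightarrow> A"
    using bd decseq_convergent[of "\<lambda>k. a (k + K)" B] by blast
  have "(\<lambda>k. a (k + K) - a (Suc k + K)) \<longlonglongrightarrow> A - A"
    using LIMSEQ_Suc[OF A] A by (intro tendsto_diff) auto
  then have lim: "(\<lambda>k. a (k + K) - a (Suc k + K)) \<longlonglongrightarrow> 0"
    by simp
  have "norm (e (k + K)) \<le> a (k + K) - a (Suc k + K)" for k
    using decr[of "k + K"] e[of "k + K"] by simp
  then have "(\<lambda>k. e (k + K)) \<longlonglongrightarrow> 0"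
    by (intro Lim_null_comparison[OF always_eventually lim]) blast
  then show ?thesis
    by (rule LIMSEQ_offset)
qed

lemma infinitely_often_near_limit_point:
  fixes x :: "nat \<Rightarrow> 'a::metric_space"
  assumes "y \<in> limit_points x" "0 < e"
  shows "\<exists>k\<ge>N. dist (x k) y < e"
proof -
  obtain r where r: "strict_mono r" "(x \<circ> r) \<longlonglongrightarrow> y"
    using assms(1) by (auto simp: limit_points_def)
  then have "\<forall>\<^sub>F t in sequentially. dist (x (r t)) y < e \<and> N \<le> r t"
    using assms(2) filterlim_subseq[OF r(1)]
    by (auto simp: tendsto_iff filterlim_at_top intro!: eventually_conj)
  then obtain t where "dist (x (r t)) y < e" "N \<le> r t"
    by (auto simp: eventually_sequentially)
  then show ?thesis
    by blast
qed

text \<open>With vanishing steps, a sequence that leaves a small ball around an isolated limit point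
  infinitely often visits a surrounding annulus infinitely often, which produces a second limit
  point nearby.\<close>

lemma isolated_limit_point_imp_tendsto:
  fixes x :: "nat \<Rightarrow> 'a::heine_borel"
  assumes iso: "y isolated_in limit_points x" and bd: "bounded (range x)"
    and step: "(\<lambda>k. dist (x (Suc k)) (x k)) \<longlonglongrightarrow> 0"
  shows "x \<longlonglongrightarrow> y"
proof (rule ccontr)
  assume "\<not> x \<longlonglongrightarrow> y"
  then obtain e0 where e0: "0 < e0" "\<not> (\<forall>\<^sub>F k in sequentially. dist (x k) y < e0)"
    by (auto simp: tendsto_iff)
  obtain e1 where y: "y \<in> limit_points x" and e1: "0 < e1"
    and only: "\<And>z. z \<in> limit_points x \<Longrightarrow> dist y z < e1 \<Longrightarrow> z = y"
    using iso by (auto simp: isolated_in_dist_Ex_iff)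
  \<comment> \<open>By \<open>e \<le> e0\<close> the sequence leaves the ball of radius
    \<open>e\<close> infinitely often; by \<open>2 * e < e1\<close> the closed annulus stays inside
    the isolating ball.\<close>
  define e where "e = min e0 e1 / 3"
  have e: "0 < e" "e \<le> e0" "2 * e < e1"
    using e0 e1 by (auto simp: e_def)
  obtain K where K: "\<And>k. K \<le> k \<Longrightarrow> dist (x (Suc k)) (x k) < e"
    using step e(1) by (auto simp: tendsto_iff eventually_sequentially)
  let ?A = "{k. e \<le> dist (x k) y \<and> dist (x k) y \<le> 2 * e}"
  have "\<exists>k\<ge>N. k \<in> ?A" for N
  proof -
    obtain k where k: "max K N \<le> k" "dist (x k) y < e"
      using infinitely_often_near_limit_point[OF y e(1)] by blast
    have far: "\<exists>j\<ge>k. e \<le> dist (x j) y"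
      using e0(2) e(2) unfolding eventually_sequentially by (force simp: not_less)
    \<comment> \<open>Just before the first exit \<open>j\<close> after \<open>k\<close>, the
      sequence is still within \<open>e\<close> of \<open>y\<close>, so a step shorter than
      \<open>e\<close> cannot jump over the annulus.\<close>
    define j where "j = (LEAST j. k \<le> j \<and> e \<le> dist (x j) y)"
    have j: "k \<le> j" "e \<le> dist (x j) y"
      using LeastI_ex[of "\<lambda>j. k \<le> j \<and> e \<le> dist (x j) y"] far by (auto simp: j_def)
    then obtain i where i: "j = Suc i" "k \<le> i"
      using k(2) by (metis le_SucE not_less not0_implies_Suc le_zero_eq)
    have "dist (x i) y < e"
      using not_less_Least[of i "\<lambda>j. k \<le> j \<and> e \<le> dist (x j) y"] i by (auto simp: j_def[symmetric])
    moreover have "dist (x j) (x i) < e"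
      using K[of i] i k by auto
    ultimately have "dist (x j) y \<le> 2 * e"
      using dist_triangle[of "x j" y "x i"] by linarith
    with j k(1) show ?thesis
      by (intro exI[of _ j]) auto
  qed
  then have "infinite ?A"
    unfolding infinite_nat_iff_unbounded_le by blast
  then obtain r :: "nat \<Rightarrow> nat" where r: "strict_mono r" "\<And>n. r n \<in> ?A"
    using infinite_enumerate by blast
  have "bounded (range (x \<circ> r))"
    using bd by (rule bounded_subset) auto
  then obtain z and s :: "nat \<Rightarrow> nat" where s: "strict_mono s" "(x \<circ> r \<circ> s) \<longlonglongrightarrow> z"
    using bounded_imp_convergent_subsequence[of "x \<circ> r"] by (auto simp: o_def)
  have "z \<in> limit_points x"
    using s r(1) strict_mono_o[OF r(1) s(1)] by (auto simp: limit_points_def o_assoc intro!: exI[of _ "r \<circ> s"])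
  moreover have lim: "(\<lambda>n. dist ((x \<circ> r \<circ> s) n) y) \<longlonglongrightarrow> dist z y"
    by (intro tendsto_dist s(2) tendsto_const)
  have "e \<le> dist z y"
    using r(2) by (intro LIMSEQ_le_const[OF lim]) auto
  moreover have "dist z y \<le> 2 * e"
    using r(2) by (intro LIMSEQ_le_const2[OF lim]) auto
  ultimately show False
    using only[of z] e by (auto simp: dist_commute)
qed

section \<open>Search directions\<close>

lemma Theta_Gamma_disjoint:
  "i \<in> Theta l u lam G \<tau> x \<Longrightarrow> i \<notin> Gamma_ul l u G \<tau> x"
  by (auto simp: Theta_def Gamma_ul_def Gamma_u_def Gamma_l_def)

text \<open>One predicate for both kinds of direction, so that the passage to the limit can treat
  them alike.\<close>

definition bnl0r_direction ::
  "real^'n \<Rightarrow> real^'n \<Rightarrow> real \<Rightarrow> (real^'n \<Rightarrow> real^'n) \<Rightarrow> (real^'n \<Rightarrow> real^'n^'n) \<Rightarrow> real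
    \<Rightarrow> real^'n \<Rightarrow> real^'n \<Rightarrow> bool" where
  "bnl0r_direction l u lam G H \<tau> x d \<longleftrightarrow>
     newton_direction l u lam G H \<tau> x d \<or> d = pgm_direction l u lam G \<tau> x"

lemma bnl0r_direction_Gamma:
  assumes "bnl0r_direction l u lam G H \<tau> x d" "i \<in> Gamma_ul l u G \<tau> x"
  shows "d $ i = proj l u (x - \<tau> *\<^sub>R G x) $ i - x $ i"
  using assms
  by (auto simp: bnl0r_direction_def newton_direction_def pgm_direction_def Iset_def Let_def)

lemma bnl0r_direction_outside:
  assumes "bnl0r_direction l u lam G H \<tau> x d" "i \<notin> Iset l u lam G \<tau> x"
  shows "d $ i = - (x $ i)"
  using assms by (auto simp: bnl0r_direction_def newton_direction_def pgm_direction_def Let_def)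

text \<open>The three blocks of the Newton system partition the index set, so together they form a
  row of the full product \<open>H x *v d\<close>.\<close>

lemma newton_direction_Theta:
  assumes d: "newton_direction l u lam G H \<tau> x d" and i: "i \<in> Theta l u lam G \<tau> x"
  shows "(H x *v d) $ i = - (G x $ i)"
proof -
  let ?Th = "Theta l u lam G \<tau> x" and ?Ga = "Gamma_ul l u G \<tau> x" and ?I = "Iset l u lam G \<tau> x"
  have "(H x *v d) $ i = (\<Sum>j\<in>UNIV. H x $ i $ j * d $ j)"
    by (simp add: matrix_vector_mult_def)
  also have "UNIV = (?Th \<union> ?Ga) \<union> - ?I"
    by (auto simp: Iset_def)
  also have "(\<Sum>j\<in>\<dots>. H x $ i $ j * d $ j) = (\<Sum>j\<in>?Th. H x $ i $ j * d $ j)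
      + (\<Sum>j\<in>?Ga. H x $ i $ j * d $ j) + (\<Sum>j\<in>- ?I. H x $ i $ j * d $ j)"
    using Theta_Gamma_disjoint[of _ l u lam G \<tau> x]
    by (subst sum.union_disjoint, (auto simp: Iset_def)[3])+ auto
  also have "\<dots> = - (G x $ i)"
    using d i unfolding newton_direction_def Let_def by blast
  finally show ?thesis .
qed

section \<open>Decrease of the objective in one step\<close>

text \<open>Strict positivity of the bounds comes from
  \<open>\<tau> < a_const l u / (2 * lam)\<close>: it makes \<open>a_const l u\<close> positive, so
  no nonnegative bound can be 0.\<close>

locale bnl0r =
  fixes f :: "real^'n \<Rightarrow> real" and G :: "real^'n \<Rightarrow> real^'n" and H :: "real^'n \<Rightarrow> real^'n^'n"
    and l u :: "real^'n" and lam L \<sigma> \<beta> \<delta> \<tau> :: real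
  assumes C2: "twice_cont_diff f G H" and smooth: "strongly_smooth L f G" and L_pos: "0 < L"
    and sigma: "0 < \<sigma>" "\<sigma> < 1" and beta: "0 < \<beta>" "\<beta> < 1" and delta: "0 < \<delta>"
    and tau: "0 < \<tau>" "\<tau> < 1 / (4 * L)"
    and l_pos: "\<And>i. 0 < l $ i" and u_pos: "\<And>i. 0 < u $ i"
begin

abbreviation "Th \<equiv> Theta l u lam G \<tau>"
abbreviation "Ga \<equiv> Gamma_ul l u G \<tau>"
abbreviation "I \<equiv> Iset l u lam G \<tau>"
abbreviation "direction \<equiv> bnl0r_direction l u lam G H \<tau>"
text \<open>Up to \<open>step_size_bound\<close> the Armijo test is sure to succeed, so accepted
  step sizes are at least \<open>\<beta>\<close> times it. \<open>decrease\<close> is the smaller of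
  the rates for projected gradient and Newton steps.\<close>

abbreviation "step_size_bound \<equiv> min 1 (2 * (1 - \<sigma>) * \<delta> / L)"
abbreviation "decrease \<equiv> min L (\<sigma> * (\<beta> * step_size_bound) * \<delta>)"

lemma proj_nth_box: "proj l u w $ i = max (- (l $ i)) (min (u $ i) (w $ i))"
  using l_pos u_pos by (intro proj_nth) (auto intro: less_imp_le)

lemma four_L_tau: "4 * L * \<tau> \<le> 1"
  using tau L_pos by (simp add: field_simps)

text \<open>The interval estimate has rate \<open>1 / \<tau>\<close>, which is at least
  \<open>4 * L\<close> by the bound on \<open>\<tau>\<close>.\<close>

lemma projected_coordinate_descent:
  assumes "x \<in> Omega l u" "d = proj l u (x - \<tau> *\<^sub>R G x) $ i - x $ i"
  shows "G x $ i * d \<le> - (4 * L * d\<^sup>2)"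
proof -
  have *: "\<tau> * (G x $ i * d) \<le> - d\<^sup>2"
    using assms tau(1) by (intro clamped_step_descent) (auto simp: mem_box_cart proj_nth_box)
  have "(4 * L * \<tau>) * d\<^sup>2 \<le> 1 * d\<^sup>2"
    by (rule mult_right_mono[OF four_L_tau]) simp
  with * have "\<tau> * (G x $ i * d) \<le> \<tau> * (- (4 * L * d\<^sup>2))"
    by (simp add: algebra_simps)
  then show ?thesis
    using mult_left_le_imp_le tau(1) by blast
qed

text \<open>For a Newton direction \<open>G x $ i\<close> is \<open>- (H x *v d) $ i\<close>; in a
  projected gradient step nothing is clamped on \<open>Th x\<close>, so \<open>d $ i\<close> is
  \<open>- (\<tau> * G x $ i)\<close>. The sum covers both cases.\<close>

lemma bnl0r_direction_Theta:
  assumes d: "direction x d" and i: "i \<in> Th x"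
  shows "\<bar>G x $ i\<bar> \<le> \<bar>(H x *v d) $ i\<bar> + \<bar>d $ i\<bar> / \<tau>"
proof (cases "newton_direction l u lam G H \<tau> x d")
  case True
  then show ?thesis
    using newton_direction_Theta[OF _ i] tau(1) by simp
next
  case False
  then have "d $ i = - (\<tau> * G x $ i)"
    using d i by (auto simp: bnl0r_direction_def pgm_direction_def proj_nth_box Iset_def Theta_def)
  then show ?thesis
    using tau(1) by (simp add: abs_mult)
qed

text \<open>Strong smoothness is split into coordinates because each index set calls for its own
  estimate.\<close>

lemma f_le_sum:
  "f (x + e) \<le> f x + (\<Sum>i\<in>UNIV. G x $ i * e $ i + L / 2 * (e $ i)\<^sup>2)"
proof -
  have "f (x + e) \<le> f x + G x \<bullet> e + L / 2 * (norm e)\<^sup>2"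
    using smooth[unfolded strongly_smooth_def, rule_format, of "x + e" x] by simp
  then show ?thesis
    by (simp add: norm_vec_square inner_vec_def sum.distrib sum_distrib_left)
qed

text \<open>On \<open>I x\<close> the projection gains \<open>4 * L\<close> times the squared
  coordinate, of which smoothness consumes only \<open>L / 2\<close>; elsewhere \<open>x\<close>,
  and hence the direction, is 0.\<close>

lemma pgm_decrease:
  assumes x: "x \<in> Omega l u" and zero: "\<And>i. i \<notin> I x \<Longrightarrow> x $ i = 0"
    and d: "d = pgm_direction l u lam G \<tau> x"
  shows "f (x + d) \<le> f x - L * (norm d)\<^sup>2"
proof -
  have "G x $ i * d $ i + L / 2 * (d $ i)\<^sup>2 \<le> - (L * (d $ i)\<^sup>2)" for i
  proof (cases "i \<in> I x")
    case True
    then have "G x $ i * d $ i \<le> - (4 * L * (d $ i)\<^sup>2)"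
      by (intro projected_coordinate_descent x) (simp add: d pgm_direction_def)
    moreover have "0 \<le> L * (d $ i)\<^sup>2"
      using L_pos by simp
    ultimately show ?thesis
      by simp
  qed (simp add: d pgm_direction_def zero)
  then have "(\<Sum>i\<in>UNIV. G x $ i * d $ i + L / 2 * (d $ i)\<^sup>2) \<le> (\<Sum>i\<in>UNIV. - (L * (d $ i)\<^sup>2))"
    by (rule sum_mono)
  then show ?thesis
    using f_le_sum[of x d] by (simp add: norm_vec_square sum_negf sum_distrib_left)
qed

lemma trial_point_diff:
  assumes zero: "\<And>i. i \<notin> I x \<Longrightarrow> x $ i = 0"
  shows "trial_point l u lam G \<tau> x d \<alpha> $ i - x $ i
    = (if i \<in> Th x then \<alpha> * d $ i else if i \<in> Ga x then d $ i else 0)"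
  using zero[of i] by (auto simp: trial_point_def Iset_def)

text \<open>On \<^term>\<open>Ga x\<close> the trial point takes the full step whatever \<open>\<alpha>\<close> is; the decrease there
  comes from the projection, with rate \<open>4 * L\<close>.\<close>

lemma armijo_small_step:
  assumes x: "x \<in> Omega l u" and zero: "\<And>i. i \<notin> I x \<Longrightarrow> x $ i = 0"
    and d: "newton_direction l u lam G H \<tau> x d" and descent: "G x \<bullet> d \<le> - \<delta> * (norm d)\<^sup>2"
    and alpha: "0 \<le> \<alpha>" "\<alpha> \<le> step_size_bound"
  shows "armijo f l u lam G \<tau> \<sigma> x d \<alpha>"
proof -
  have dir: "direction x d"
    using d by (simp add: bnl0r_direction_def)
  have a1: "\<alpha> \<le> 1" and aL: "\<alpha> * L / 2 \<le> (1 - \<sigma>) * \<delta>"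
    using alpha L_pos by (auto simp: field_simps)
  \<comment> \<open>The product is \<open>(1 - \<alpha>) * (4 * L) + \<alpha> * (\<alpha> * L / 2) -
    L / 2\<close>, factored.\<close>
  have "0 \<le> (1 - \<alpha>) * (7 - \<alpha>) * L / 2"
    using alpha a1 L_pos by simp
  then have "L / 2 \<le> (1 - \<alpha>) * (4 * L) + \<alpha> * (\<alpha> * L / 2)"
    by (simp add: field_simps)
  also have "\<dots> \<le> (1 - \<alpha>) * (4 * L) + \<alpha> * ((1 - \<sigma>) * \<delta>)"
    using mult_left_mono[OF aL alpha(1)] by simp
  \<comment> \<open>The curvature \<open>L / 2\<close> of the full step on \<open>Ga x\<close> is
    paid by the share \<open>1 - \<alpha>\<close> of the projection rate and by
    \<open>\<alpha>\<close> times the slack \<open>(1 - \<sigma>) * \<delta>\<close>.\<close>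
  finally have key: "L / 2 \<le> (1 - \<alpha>) * (4 * L) + \<alpha> * ((1 - \<sigma>) * \<delta>)" .
  define e where "e = trial_point l u lam G \<tau> x d \<alpha> - x"
  \<comment> \<open>Summed up, the right side is \<open>\<alpha> * (G x \<bullet> d)\<close> plus a
    remainder that the share \<open>1 - \<sigma>\<close> of the descent inequality absorbs; the
    Armijo term is left.\<close>
  have coord: "G x $ i * e $ i + L / 2 * (e $ i)\<^sup>2
      \<le> \<alpha> * (G x $ i * d $ i) + \<alpha> * ((1 - \<sigma>) * \<delta>) * (d $ i)\<^sup>2" for i
  proof -
    consider "i \<in> Th x" | "i \<in> Ga x" "i \<notin> Th x" | "i \<notin> I x"
      by (auto simp: Iset_def)
    then show ?thesis
    proof cases
      case 1
      have "\<alpha> * (\<alpha> * L / 2) * (d $ i)\<^sup>2 \<le> \<alpha> * ((1 - \<sigma>) * \<delta>) * (d $ i)\<^sup>2"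
        using aL alpha(1) by (intro mult_right_mono mult_left_mono) auto
      moreover have "e $ i = \<alpha> * d $ i"
        using 1 by (simp add: e_def trial_point_diff[OF zero])
      ultimately show ?thesis
        by (simp add: power2_eq_square algebra_simps)
    next
      case 2
      have e: "e $ i = d $ i"
        using 2 by (simp add: e_def trial_point_diff[OF zero])
      have "G x $ i * d $ i \<le> - (4 * L * (d $ i)\<^sup>2)"
        using bnl0r_direction_Gamma[OF dir 2(1)] by (intro projected_coordinate_descent x)
      then have "(1 - \<alpha>) * (G x $ i * d $ i) \<le> (1 - \<alpha>) * (- (4 * L * (d $ i)\<^sup>2))"
        using a1 by (intro mult_left_mono) auto
      moreover have "L / 2 * (d $ i)\<^sup>2
          \<le> ((1 - \<alpha>) * (4 * L) + \<alpha> * ((1 - \<sigma>) * \<delta>)) * (d $ i)\<^sup>2"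
        by (rule mult_right_mono[OF key]) simp
      ultimately show ?thesis
        unfolding e by (simp add: algebra_simps)
    next
      case 3
      then have "e $ i = 0" "d $ i = 0"
        using bnl0r_direction_outside[OF dir 3] zero[OF 3]
        by (auto simp: e_def trial_point_def Iset_def)
      then show ?thesis
        by simp
    qed
  qed
  have "f (x + e) \<le> f x + (\<Sum>i\<in>UNIV. G x $ i * e $ i + L / 2 * (e $ i)\<^sup>2)"
    by (rule f_le_sum)
  also have "\<dots> \<le> f x + (\<Sum>i\<in>UNIV. \<alpha> * (G x $ i * d $ i) + \<alpha> * ((1 - \<sigma>) * \<delta>) * (d $ i)\<^sup>2)"
    using coord by (intro add_left_mono sum_mono)
  also have "\<dots> = f x + \<alpha> * (G x \<bullet> d) + \<alpha> * ((1 - \<sigma>) * \<delta>) * (norm d)\<^sup>2"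
    by (simp add: sum.distrib inner_vec_def norm_vec_square sum_distrib_left)
  also have "\<dots> \<le> f x + \<sigma> * \<alpha> * (G x \<bullet> d)"
  proof -
    have "(\<alpha> * (1 - \<sigma>)) * (G x \<bullet> d) \<le> (\<alpha> * (1 - \<sigma>)) * (- \<delta> * (norm d)\<^sup>2)"
      using descent alpha(1) sigma by (intro mult_left_mono) auto
    then show ?thesis
      by (simp add: algebra_simps)
  qed
  finally show ?thesis
    by (simp add: armijo_def e_def)
qed

text \<open>Backtracking stops at once or has just rejected \<open>\<beta> ^ j\<close> with
  \<open>m = Suc j\<close>. A rejected size exceeds \<open>step_size_bound\<close>, so the accepted
  one is at least \<open>\<beta> * step_size_bound\<close>.\<close>

lemma newton_decrease:
  assumes x: "x \<in> Omega l u" and zero: "\<And>i. i \<notin> I x \<Longrightarrow> x $ i = 0"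
    and d: "newton_direction l u lam G H \<tau> x d"
    and acc: "newton_acceptable l u lam G \<tau> \<delta> Iprev x d"
    and step: "newton_step f l u lam G \<tau> \<sigma> \<beta> x d x'"
  shows "f x' \<le> f x - \<sigma> * (\<beta> * step_size_bound) * \<delta> * (norm d)\<^sup>2" "norm (x' - x) \<le> norm d"
proof -
  have dir: "direction x d"
    using d by (simp add: bnl0r_direction_def)
  have d0: "i \<notin> I x \<Longrightarrow> d $ i = 0" for i
    using bnl0r_direction_outside[OF dir] zero by force
  \<comment> \<open>As \<open>x\<close> and \<open>d\<close> vanish outside \<open>I x\<close>, the
    acceptance test becomes a descent inequality for the full inner product, its term with
    \<open>4 * \<tau>\<close> being 0.\<close>
  have "G x \<bullet> d = (\<Sum>i\<in>I x. G x $ i * d $ i)"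
    unfolding inner_vec_def by (rule sum.mono_neutral_cong_right) (auto simp: d0)
  also have "\<dots> \<le> - \<delta> * (norm d)\<^sup>2 + (\<Sum>i\<in>- I x. (x $ i)\<^sup>2) / (4 * \<tau>)"
    using acc by (simp add: newton_acceptable_def Let_def)
  also have "(\<Sum>i\<in>- I x. (x $ i)\<^sup>2) = 0"
    using zero by (intro sum.neutral) auto
  finally have descent: "G x \<bullet> d \<le> - \<delta> * (norm d)\<^sup>2"
    by simp
  obtain m where m: "armijo f l u lam G \<tau> \<sigma> x d (\<beta> ^ m)"
      "\<And>j. j < m \<Longrightarrow> \<not> armijo f l u lam G \<tau> \<sigma> x d (\<beta> ^ j)"
      and x': "x' = trial_point l u lam G \<tau> x d (\<beta> ^ m)"
    using step by (auto simp: newton_step_def)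
  have pos: "0 < step_size_bound"
    using sigma delta L_pos by simp
  have "\<beta> * step_size_bound \<le> \<beta> ^ m"
  proof (cases m)
    case 0
    have "\<beta> * step_size_bound \<le> 1 * 1"
      using beta pos by (intro mult_mono) auto
    with 0 show ?thesis
      by simp
  next
    case (Suc j)
    have "\<not> \<beta> ^ j \<le> step_size_bound"
      using armijo_small_step[OF x zero d descent, of "\<beta> ^ j"] m(2)[of j] beta Suc by auto
    then show ?thesis
      using beta Suc by (simp only: power_Suc) (intro mult_left_mono, auto)
  qed
  then have "\<sigma> * (\<beta> * step_size_bound) * (\<delta> * (norm d)\<^sup>2) \<le> \<sigma> * \<beta> ^ m * (\<delta> * (norm d)\<^sup>2)"
    using sigma delta by (intro mult_right_mono mult_left_mono) auto
  moreover have "\<sigma> * \<beta> ^ m * (G x \<bullet> d) \<le> \<sigma> * \<beta> ^ m * (- \<delta> * (norm d)\<^sup>2)"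
    using sigma beta descent by (intro mult_left_mono) auto
  moreover have "f x' \<le> f x + \<sigma> * \<beta> ^ m * (G x \<bullet> d)"
    using m(1) x' by (simp add: armijo_def)
  ultimately show "f x' \<le> f x - \<sigma> * (\<beta> * step_size_bound) * \<delta> * (norm d)\<^sup>2"
    by (simp add: algebra_simps)
  show "norm (x' - x) \<le> norm d"
  proof (rule norm_le_componentwise_cart)
    fix i
    have "\<bar>\<beta> ^ m * d $ i\<bar> \<le> 1 * \<bar>d $ i\<bar>"
      unfolding abs_mult using beta by (intro mult_right_mono) (auto simp: power_le_one)
    moreover have "(x' - x) $ i = (if i \<in> Th x then \<beta> ^ m * d $ i else if i \<in> Ga x then d $ i else 0)"
      unfolding x' vector_minus_component by (rule trial_point_diff) (rule zero)
    ultimately show "norm ((x' - x) $ i) \<le> norm (d $ i)"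
      by (simp del: vector_minus_component)
  qed
qed

lemma step_decrease:
  assumes x: "x \<in> Omega l u" and zero: "\<And>i. i \<notin> I x \<Longrightarrow> x $ i = 0"
    and step: "bnl0r_step f G H l u lam \<tau> \<sigma> \<beta> \<delta> Iprev x x'"
  shows "\<exists>d. direction x d \<and> f x' \<le> f x - decrease * (norm d)\<^sup>2 \<and> norm (x' - x) \<le> norm d"
proof -
  have weaken: "y \<le> f x - decrease * (norm d)\<^sup>2"
    if "y \<le> f x - c * (norm d)\<^sup>2" "decrease \<le> c" for y c and d :: "real^'n"
    using that mult_right_mono[OF that(2), of "(norm d)\<^sup>2"] by simp
  from step consider d where "newton_direction l u lam G H \<tau> x d"
      "newton_acceptable l u lam G \<tau> \<delta> Iprev x d" "newton_step f l u lam G \<tau> \<sigma> \<beta> x d x'"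
    | "x' = x + pgm_direction l u lam G \<tau> x"
    unfolding bnl0r_step_def by blast
  then show ?thesis
  proof cases
    case 1
    then show ?thesis
      using newton_decrease[OF x zero 1] weaken[OF newton_decrease(1)[OF x zero 1]]
      by (auto simp: bnl0r_direction_def)
  next
    case 2
    then show ?thesis
      using weaken[OF pgm_decrease[OF x zero refl]]
      by (intro exI[of _ "pgm_direction l u lam G \<tau> x"]) (simp add: bnl0r_direction_def)
  qed
qed

text \<open>On \<open>Th x\<close> the trial point agrees with a convex combination of
  \<open>x\<close> and \<open>x + d\<close>, on \<open>Ga x\<close> with \<open>x + d\<close>
  itself; elsewhere it is 0. A projected gradient step gives clamped coordinates or zeros.\<close>

lemma step_feasible:
  assumes x: "x \<in> Omega l u" and step: "bnl0r_step f G H l u lam \<tau> \<sigma> \<beta> \<delta> Iprev x x'"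
  shows "x' \<in> Omega l u" and "\<And>i. i \<notin> I x \<Longrightarrow> x' $ i = 0"
proof -
  have "- (l $ i) \<le> x' $ i \<and> x' $ i \<le> u $ i \<and> (i \<notin> I x \<longrightarrow> x' $ i = 0)" for i
  proof -
    from step consider d m where "newton_acceptable l u lam G \<tau> \<delta> Iprev x d"
        "x' = trial_point l u lam G \<tau> x d (\<beta> ^ m)"
      | "x' = x + pgm_direction l u lam G \<tau> x"
      unfolding bnl0r_step_def newton_step_def by blast
    then show ?thesis
    proof cases
      case 1
      have "x + d \<in> Omega l u"
        using 1 by (simp add: newton_acceptable_def Let_def)
      moreover have "x + (\<beta> ^ m) *\<^sub>R d \<in> Omega l u"
      proof -
        have "(1 - \<beta> ^ m) *\<^sub>R x + (\<beta> ^ m) *\<^sub>R (x + d) \<in> Omega l u"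
          using x \<open>x + d \<in> Omega l u\<close> beta
          by (intro convexD) (auto simp: convex_box power_le_one)
        then show ?thesis
          by (simp add: algebra_simps)
      qed
      ultimately show ?thesis
        using 1 l_pos[of i] u_pos[of i]
        by (auto simp: trial_point_def mem_box_cart Iset_def)
    next
      case 2
      then show ?thesis
        using l_pos[of i] u_pos[of i] by (auto simp: pgm_direction_def proj_nth_box)
    qed
  qed
  then show "x' \<in> Omega l u" and "\<And>i. i \<notin> I x \<Longrightarrow> x' $ i = 0"
    by (auto simp: mem_box_cart)
qed

section \<open>Feasibility of the run and vanishing steps\<close>

lemma run_in_box:
  assumes "bnl0r_sequence f G H l u lam \<tau> \<sigma> \<beta> \<delta> x"
  shows "x k \<in> Omega l u"
proof (induction k)
  case 0
  then show ?case
    using assms by (simp add: bnl0r_sequence_def)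
next
  case (Suc k)
  then show ?case
    using assms step_feasible(1) unfolding bnl0r_sequence_def by blast
qed

text \<open>With a stable index set the one-step decrease holds at every late iterate. As
  \<open>f\<close> is bounded below, the norms of the directions tend to 0, and they dominate the
  steps.\<close>

lemma directions_vanish:
  assumes run: "bnl0r_sequence f G H l u lam \<tau> \<sigma> \<beta> \<delta> x" and bd: "bdd_below (range f)"
    and const: "\<And>k. K \<le> k \<Longrightarrow> I (x k) = J"
    and zero: "\<And>k i. K \<le> k \<Longrightarrow> i \<notin> J \<Longrightarrow> x k $ i = 0"
  obtains d where "\<And>k. K \<le> k \<Longrightarrow> direction (x k) (d k)" "d \<longlonglongrightarrow> 0"
    "(\<lambda>k. dist (x (Suc k)) (x k)) \<longlonglongrightarrow> 0"
proof -
  define c where "c = decrease"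
  have pos: "0 < c"
    using L_pos sigma beta delta by (simp add: c_def)
  \<comment> \<open>With \<open>K \<le> k\<close> under the quantifier, one sequence can be chosen
    on all indices; its terms before \<open>K\<close> are arbitrary.\<close>
  have "\<exists>d. K \<le> k \<longrightarrow> direction (x k) d \<and> f (x (Suc k)) \<le> f (x k) - c * (norm d)\<^sup>2
      \<and> norm (x (Suc k) - x k) \<le> norm d" for k
    using step_decrease[OF run_in_box[OF run, of k]] run zero[of k] const[of k]
    unfolding bnl0r_sequence_def c_def by metis
  then obtain d where d: "\<And>k. K \<le> k \<Longrightarrow> direction (x k) (d k)"
      "\<And>k. K \<le> k \<Longrightarrow> f (x (Suc k)) \<le> f (x k) - c * (norm (d k))\<^sup>2"
      "\<And>k. K \<le> k \<Longrightarrow> norm (x (Suc k) - x k) \<le> norm (d k)"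
    by metis
  obtain B where B: "\<And>y. B \<le> f y"
    using bd by (auto simp: bdd_below_def)
  have "0 \<le> c * (norm (d k))\<^sup>2" for k
    using pos by simp
  then have "(\<lambda>k. c * (norm (d k))\<^sup>2) \<longlonglongrightarrow> 0"
    using sufficient_decrease_tendsto_zero[where a = "\<lambda>k. f (x k)" and K = K and B = B, OF d(2) _ B]
    by blast
  then have "(\<lambda>k. c * (norm (d k))\<^sup>2 / c) \<longlonglongrightarrow> 0 / c"
    by (intro tendsto_divide tendsto_const) (use pos in simp)+
  then have "(\<lambda>k. sqrt ((norm (d k))\<^sup>2)) \<longlonglongrightarrow> sqrt 0"
    using pos by (intro tendsto_real_sqrt) simp
  then have lim: "(\<lambda>k. norm (d k)) \<longlonglongrightarrow> 0"
    by simp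
  moreover have "(\<lambda>k. dist (x (Suc k)) (x k)) \<longlonglongrightarrow> 0"
    by (rule Lim_null_comparison[OF _ lim])
      (use d(3) in \<open>auto simp: dist_norm eventually_sequentially\<close>)
  ultimately show ?thesis
    using that[of d] d(1) tendsto_norm_zero_iff[of d] by blast
qed

section \<open>Passage to the limit\<close>

lemma G_tendsto:
  assumes "y \<longlonglongrightarrow> z"
  shows "(\<lambda>k. G (y k)) \<longlonglongrightarrow> G z"
proof -
  have "isCont G z"
    using C2 unfolding twice_cont_diff_def by (meson has_derivative_continuous)
  then show ?thesis
    using assms by (rule isCont_tendsto_compose)
qed

lemma H_mult_tendsto_zero:
  assumes "y \<longlonglongrightarrow> z" "d \<longlonglongrightarrow> 0"
  shows "(\<lambda>k. (H (y k) *v d k) $ i) \<longlonglongrightarrow> 0"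
proof -
  have "(\<lambda>k. H (y k)) \<longlonglongrightarrow> H z"
    using C2 assms(1) unfolding twice_cont_diff_def
    by (intro isCont_tendsto_compose[of z H]) (auto simp: continuous_on_eq_continuous_at)
  then have "(\<lambda>k. \<Sum>j\<in>UNIV. H (y k) $ i $ j * d k $ j) \<longlonglongrightarrow> (\<Sum>j\<in>UNIV. H z $ i $ j * 0 $ j)"
    using assms(2) by (intro tendsto_sum tendsto_mult tendsto_vec_nth)
  then show ?thesis
    by (simp add: matrix_vector_mult_def)
qed

context
  fixes y d :: "nat \<Rightarrow> real^'n" and z :: "real^'n"
  assumes y: "y \<longlonglongrightarrow> z" and d: "d \<longlonglongrightarrow> 0"
    and dir: "\<forall>\<^sub>F k in sequentially. direction (y k) (d k)"
begin

lemma gradient_step_tendsto: "(\<lambda>k. y k $ i - \<tau> * G (y k) $ i) \<longlonglongrightarrow> z $ i - \<tau> * G z $ i"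
  by (intro tendsto_intros tendsto_vec_nth y G_tendsto)

text \<open>The bound of \<open>bnl0r_direction_Theta\<close> tends to 0, so the gradient coordinate
  vanishes. The gradient step then tends to \<open>z $ i\<close> itself, and the threshold survives
  the limit.\<close>

lemma limit_Theta:
  assumes i: "\<And>k. i \<in> Th (y k)"
  shows "G z $ i = 0" "2 * \<tau> * lam \<le> (z $ i)\<^sup>2"
proof -
  have "(\<lambda>k. \<bar>(H (y k) *v d k) $ i\<bar> + \<bar>d k $ i\<bar> / \<tau>) \<longlonglongrightarrow> \<bar>0\<bar> + \<bar>0 $ i\<bar> / \<tau>"
    using tau(1) by (intro tendsto_intros tendsto_vec_nth H_mult_tendsto_zero[OF y d] d) auto
  then have lim: "(\<lambda>k. \<bar>(H (y k) *v d k) $ i\<bar> + \<bar>d k $ i\<bar> / \<tau>) \<longlonglongrightarrow> 0"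
    by simp
  have "(\<lambda>k. G (y k) $ i) \<longlonglongrightarrow> 0"
    by (rule Lim_null_comparison[OF _ lim])
      (use dir in eventually_elim, simp add: bnl0r_direction_Theta i)
  moreover have "(\<lambda>k. G (y k) $ i) \<longlonglongrightarrow> G z $ i"
    by (intro tendsto_vec_nth G_tendsto y)
  ultimately show g: "G z $ i = 0"
    using LIMSEQ_unique by blast
  have "(\<lambda>k. \<bar>y k $ i - \<tau> * G (y k) $ i\<bar>) \<longlonglongrightarrow> \<bar>z $ i - \<tau> * G z $ i\<bar>"
    by (intro tendsto_rabs gradient_step_tendsto)
  then have "sqrt (2 * \<tau> * lam) \<le> \<bar>z $ i\<bar>"
    using LIMSEQ_le_const[of _ "\<bar>z $ i - \<tau> * G z $ i\<bar>" "sqrt (2 * \<tau> * lam)"] i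
    by (auto simp: Theta_def g)
  then show "2 * \<tau> * lam \<le> (z $ i)\<^sup>2"
    using sqrt_le_D by fastforce
qed

text \<open>On \<open>Ga\<close> the direction is the projection residual, which is continuous in
  the point; its limit is both 0 and the residual at \<open>z\<close>.\<close>

lemma limit_Gamma:
  assumes i: "\<And>k. i \<in> Ga (y k)"
  shows "proj l u (z - \<tau> *\<^sub>R G z) $ i = z $ i"
proof -
  have "(\<lambda>k. d k $ i) \<longlonglongrightarrow> 0 $ i"
    by (intro tendsto_vec_nth d)
  moreover have "\<forall>\<^sub>F k in sequentially. d k $ i = proj l u (y k - \<tau> *\<^sub>R G (y k)) $ i - y k $ i"
    using dir by eventually_elim (rule bnl0r_direction_Gamma[OF _ i])
  ultimately have "(\<lambda>k. proj l u (y k - \<tau> *\<^sub>R G (y k)) $ i - y k $ i) \<longlonglongrightarrow> 0"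
    by (simp add: tendsto_cong)
  moreover have "(\<lambda>k. proj l u (y k - \<tau> *\<^sub>R G (y k)) $ i - y k $ i)
      \<longlonglongrightarrow> proj l u (z - \<tau> *\<^sub>R G z) $ i - z $ i"
    unfolding proj_nth_box vector_minus_component vector_scaleR_component real_scaleR_def
    by (intro tendsto_intros tendsto_max tendsto_min gradient_step_tendsto tendsto_vec_nth y)
  ultimately show ?thesis
    using LIMSEQ_unique by fastforce
qed

text \<open>The limit of the gradient steps is still at least \<open>u $ i\<close>, hence clamped to
  \<open>u $ i\<close>, which \<open>limit_Gamma\<close> identifies with \<open>z $ i\<close>.
  Substituting back gives the sign of the gradient.\<close>

lemma limit_Gamma_u:
  assumes i: "\<And>k. i \<in> Gamma_u u G \<tau> (y k)"
  shows "z $ i = u $ i" "G z $ i \<le> 0"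
proof -
  have ge: "u $ i \<le> z $ i - \<tau> * G z $ i"
    using i by (intro LIMSEQ_le_const[OF gradient_step_tendsto]) (auto simp: Gamma_u_def)
  then show eq: "z $ i = u $ i"
    using limit_Gamma[of i] i l_pos[of i] u_pos[of i] by (auto simp: Gamma_ul_def proj_nth_box)
  show "G z $ i \<le> 0"
    using ge eq tau(1) by (simp add: mult_le_0_iff)
qed

lemma limit_Gamma_l:
  assumes i: "\<And>k. i \<in> Gamma_l l G \<tau> (y k)"
  shows "z $ i = - (l $ i)" "0 \<le> G z $ i"
proof -
  have le: "z $ i - \<tau> * G z $ i \<le> - (l $ i)"
    using i by (intro LIMSEQ_le_const2[OF gradient_step_tendsto]) (auto simp: Gamma_l_def)
  then show eq: "z $ i = - (l $ i)"
    using limit_Gamma[of i] i l_pos[of i] u_pos[of i] by (auto simp: Gamma_ul_def proj_nth_box)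
  show "0 \<le> G z $ i"
    using le eq tau(1) by (simp add: zero_le_mult_iff)
qed

end

end

section \<open>Stationarity from conditions on single coordinates\<close>

text \<open>The proximal objective separates, and each coordinate of \<open>x\<close> minimizes its
  own term. At a zero entry, \<open>out\<close> says that leaving 0 costs at least what it can gain;
  at a nonzero entry, \<open>large\<close> handles the competitor 0 and \<open>kkt\<close> all
  others.\<close>

lemma stationary_pointI:
  fixes x :: "real^'n"
  assumes x: "x \<in> Omega l u" and t: "0 < t" and lam: "0 < lam"
    and out: "\<And>i. x $ i = 0 \<Longrightarrow> (t * G x $ i)\<^sup>2 \<le> 2 * t * lam"
    and large: "\<And>i. x $ i \<noteq> 0 \<Longrightarrow> 2 * t * lam \<le> (x $ i)\<^sup>2"
    and kkt: "\<And>i. x $ i \<noteq> 0 \<Longrightarrow>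
      G x $ i = 0 \<or> x $ i = u $ i \<and> G x $ i \<le> 0 \<or> x $ i = - (l $ i) \<and> 0 \<le> G x $ i"
  shows "stationary_point l u lam G t x"
proof -
  let ?w = "x - t *\<^sub>R G x"
  let ?F = "\<lambda>y. 1 / 2 * (norm (y - ?w))\<^sup>2 + t * lam * real (l0 y)"
  let ?c = "\<lambda>y i. 1 / 2 * (y $ i - ?w $ i)\<^sup>2 + t * lam * (if y $ i = 0 then 0 else 1)"
  have F: "?F y = (\<Sum>i\<in>UNIV. ?c y i)" for y :: "real^'n"
  proof -
    have "real (l0 y) = (\<Sum>i\<in>UNIV. if y $ i = 0 then 0 else 1)"
      by (simp add: supp_def sum.If_cases Compl_eq)
    then show ?thesis
      by (simp only: norm_vec_square sum.distrib sum_distrib_left vector_minus_component)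
  qed
  have min: "?F x \<le> ?F y" if y: "y \<in> Omega l u" for y
    unfolding F
  proof (rule sum_mono)
    fix i
    have tl: "0 < t * lam"
      using t lam by simp
    \<comment> \<open>Expanded around \<open>x\<close>, the quadratic has the same last term for
      \<open>x\<close> and \<open>y\<close>, and for nonzero \<open>x $ i\<close> a cross term that
      \<open>kkt\<close> makes nonnegative.\<close>
    have exp: "(y $ i - ?w $ i)\<^sup>2
        = (y $ i - x $ i)\<^sup>2 + 2 * (t * (G x $ i * (y $ i - x $ i))) + (t * G x $ i)\<^sup>2"
      by (simp add: power2_eq_square algebra_simps)
    have wx: "(x $ i - ?w $ i)\<^sup>2 = (t * G x $ i)\<^sup>2"
      by simp
    show "?c x i \<le> ?c y i"
    proof (cases "x $ i = 0")
      case True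
      then show ?thesis
        using out[OF True] tl
        by (cases "y $ i = 0") (auto simp: algebra_simps intro: add_increasing2)
    next
      case False
      have "0 \<le> G x $ i * (y $ i - x $ i)"
        using kkt[OF False] y by (auto simp: mem_box_cart zero_le_mult_iff)
      then have "0 \<le> t * (G x $ i * (y $ i - x $ i))"
        using t by simp
      then show ?thesis
        unfolding exp wx using False large[OF False] tl by (cases "y $ i = 0") auto
    qed
  qed
  \<comment> \<open>The factor \<open>t * lam\<close> is positive, so the penalty stays infinite off
    the box, and it remains to minimize the real function \<open>?F\<close> over the box.\<close>
  have obj: "ereal (1 / 2 * (norm (y - ?w))\<^sup>2) + ereal (t * lam) * l0_box l u y
      = (if y \<in> Omega l u then ereal (?F y) else \<infinity>)" for y
    using t lam by (simp add: l0_box_def)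
  show ?thesis
    unfolding stationary_point_def Prox_def is_arg_min_def mem_Collect_eq obj
    using x min by (auto simp: not_less)
qed

theorem theorem6:
  fixes f :: "real^'n \<Rightarrow> real"
    and G :: "real^'n \<Rightarrow> real^'n"
    and H :: "real^'n \<Rightarrow> real^'n^'n"
    and l u :: "real^'n"
    and lam L \<sigma> \<beta> \<delta> \<tau> :: real
    and x :: "nat \<Rightarrow> real^'n"
    and I_inf :: "'n set"
    and xs :: "real^'n"
  assumes f_C2: "twice_cont_diff f G H"
    and f_bdd: "bdd_below (range f)"
    and grad0: "G 0 \<noteq> 0"
    and l_nonneg: "\<forall>i. l $ i \<ge> 0"
    and u_nonneg: "\<forall>i. u $ i \<ge> 0"
    and L_pos: "L > 0"
    and f_smooth: "strongly_smooth L f G"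
    and \<sigma>: "0 < \<sigma>" "\<sigma> < 1 / 2"
    and \<beta>: "0 < \<beta>" "\<beta> < 1"
    and \<delta>: "0 < \<delta>" "\<delta> < min 1 (2 * L)"
    and lam: "0 < lam" "lam < lam_upper G \<tau>"
    and \<tau>: "0 < \<tau>" "\<tau> < a_const l u / (2 * lam)" "\<tau> < tau_bar l u lam G \<sigma> \<beta> \<delta> L"
    and run: "bnl0r_sequence f G H l u lam \<tau> \<sigma> \<beta> \<delta> x"
    and I_inf: "\<forall>\<^sub>F k in sequentially. Iset l u lam G \<tau> (x k) = I_inf"
    and xs: "xs \<in> limit_points x"
    and sc: "strict_complementarity l u G I_inf xs"
    and cq: "abadie_cq l u I_inf xs"
  shows
    "(\<exists>(r :: nat \<Rightarrow> nat) Theta_inf Gamma_inf Gamma_u_inf Gamma_l_inf.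
        strict_mono r \<and> (x \<circ> r) \<longlonglongrightarrow> xs \<and>
        (\<forall>\<^sub>F t in sequentially. Theta l u lam G \<tau> (x (r t)) = Theta_inf) \<and>
        (\<forall>\<^sub>F t in sequentially. Gamma_ul l u G \<tau> (x (r t)) = Gamma_inf) \<and>
        (\<forall>\<^sub>F t in sequentially. Gamma_u u G \<tau> (x (r t)) = Gamma_u_inf) \<and>
        (\<forall>\<^sub>F t in sequentially. Gamma_l l G \<tau> (x (r t)) = Gamma_l_inf) \<and>
        I_inf = Theta_inf \<union> Gamma_inf \<and>
        (\<forall>i\<in>Theta_inf. G xs $ i = 0) \<and>
        (\<forall>i\<in>Gamma_inf. proj l u (xs - \<tau> *\<^sub>R G xs) $ i - xs $ i = 0) \<and>
        (\<forall>i\<in>Gamma_u_inf. xs $ i = u $ i) \<and>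
        (\<forall>i\<in>Gamma_l_inf. xs $ i = - (l $ i))) \<and>
     (\<forall>i\<in>- I_inf. xs $ i = 0) \<and>
     supp xs \<subseteq> I_inf \<and>
     xs \<noteq> 0 \<and>
     xs \<in> Omega l u \<and>
     (\<forall>tau_s. 0 < tau_s \<and> tau_s < tau_star_bound l u lam G \<sigma> \<beta> \<delta> L xs
        \<longrightarrow> stationary_point l u lam G tau_s xs) \<and>
     (xs isolated_in limit_points x \<longrightarrow> x \<longlonglongrightarrow> xs)"
proof -
  have a: "2 * \<tau> * lam < a_const l u"
    using \<tau>(2) lam(1) by (simp add: field_simps)
  have "a_const l u \<le> min ((l $ i)\<^sup>2) ((u $ i)\<^sup>2)" for i
    unfolding a_const_def by (rule Min_le) auto
  then have "a_const l u \<le> (l $ i)\<^sup>2" "a_const l u \<le> (u $ i)\<^sup>2" for i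
    by simp_all
  with a have large: "2 * \<tau> * lam < (l $ i)\<^sup>2" "2 * \<tau> * lam < (u $ i)\<^sup>2" for i
    by (meson less_le_trans)+
  have tl: "0 < 2 * \<tau> * lam"
    using \<tau>(1) lam(1) by simp
  have "l $ i \<noteq> 0" "u $ i \<noteq> 0" for i
    using large[of i] tl by auto
  then have pos: "0 < l $ i" "0 < u $ i" for i
    using l_nonneg u_nonneg by (simp_all add: less_le)
  have tauL: "\<tau> < 1 / (4 * L)"
    using \<tau>(3) by (simp add: tau_bar_def)
  interpret bnl0r f G H l u lam L \<sigma> \<beta> \<delta> \<tau>
    by unfold_locales (use assms pos tauL in auto)
  have step: "bnl0r_step f G H l u lam \<tau> \<sigma> \<beta> \<delta>
      (case k of 0 \<Rightarrow> {} | Suc j \<Rightarrow> I (x j)) (x k) (x (Suc k))" for k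
    using run by (simp add: bnl0r_sequence_def)
  have box: "x k \<in> Omega l u" for k
    by (rule run_in_box[OF run])
  obtain K where K: "\<And>k. K \<le> k \<Longrightarrow> I (x k) = I_inf"
    using I_inf by (auto simp: eventually_sequentially)
  \<comment> \<open>The range starts at \<open>Suc K\<close> because an iterate vanishes outside the
    index set of its predecessor.\<close>
  have zero: "x k $ i = 0" if "Suc K \<le> k" "i \<notin> I_inf" for k i
  proof -
    have "k = Suc (k - 1)" "K \<le> k - 1"
      using that(1) by simp_all
    then obtain j where "k = Suc j" "K \<le> j"
      by blast
    then show ?thesis
      using step_feasible(2)[OF box step, of i j] K[of j] that(2) by simp
  qed
  obtain d where d: "\<And>k. Suc K \<le> k \<Longrightarrow> direction (x k) (d k)" "d \<longlonglongrightarrow> 0"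
    and dist0: "(\<lambda>k. dist (x (Suc k)) (x k)) \<longlonglongrightarrow> 0"
    by (rule directions_vanish[OF run f_bdd K[OF Suc_leD] zero]) blast+

  obtain r0 where r0: "strict_mono r0" "(x \<circ> r0) \<longlonglongrightarrow> xs"
    using xs by (auto simp: limit_points_def)
  let ?sets = "\<lambda>k. (Th (x k), Gamma_u u G \<tau> (x k), Gamma_l l G \<tau> (x k))"
  \<comment> \<open>There are only finitely many triples of index sets, so one recurs infinitely
    often along \<open>r0\<close>; \<open>t0\<close> represents it.\<close>
  obtain t0 where t0: "infinite {t \<in> UNIV. ?sets (r0 t) = ?sets (r0 t0)}"
    using pigeonhole_infinite[of "UNIV :: nat set" "\<lambda>t. ?sets (r0 t)"] by auto
  then obtain s :: "nat \<Rightarrow> nat" where s: "strict_mono s" "\<And>t. ?sets (r0 (s t)) = ?sets (r0 t0)"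
    using infinite_enumerate[OF t0] by blast
  define r where "r = r0 \<circ> s"
  define Th0 where "Th0 = Th (x (r0 t0))"
  define Gu where "Gu = Gamma_u u G \<tau> (x (r0 t0))"
  define Gl where "Gl = Gamma_l l G \<tau> (x (r0 t0))"
  have sets: "Th (x (r t)) = Th0" "Gamma_u u G \<tau> (x (r t)) = Gu" "Gamma_l l G \<tau> (x (r t)) = Gl"
      "Ga (x (r t)) = Gu \<union> Gl" for t
    using s(2)[of t] by (simp_all add: r_def Th0_def Gu_def Gl_def Gamma_ul_def)
  have r: "strict_mono r"
    unfolding r_def by (rule strict_mono_o[OF r0(1) s(1)])
  have lim: "(\<lambda>t. x (r t)) \<longlonglongrightarrow> xs"
    using LIMSEQ_subseq_LIMSEQ[OF r0(2) s(1)] by (simp add: r_def o_def)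
  have dlim: "(\<lambda>t. d (r t)) \<longlonglongrightarrow> 0"
    using LIMSEQ_subseq_LIMSEQ[OF d(2) r] by (simp add: o_def)
  have late: "\<forall>\<^sub>F t in sequentially. Suc K \<le> r t"
    using filterlim_subseq[OF r] by (simp add: filterlim_at_top)
  then have dir: "\<forall>\<^sub>F t in sequentially. direction (x (r t)) (d (r t))"
    by eventually_elim (rule d(1))
  obtain t1 where t1: "Suc K \<le> r t1"
    using late by (auto simp: eventually_sequentially)
  have I_eq: "I_inf = Th0 \<union> (Gu \<union> Gl)"
    using K[of "r t1"] t1 sets[of t1] by (auto simp: Iset_def)

  have limit_Th: "G xs $ i = 0" "2 * \<tau> * lam \<le> (xs $ i)\<^sup>2" if "i \<in> Th0" for i
    using limit_Theta[OF lim dlim dir, of i] that by (simp_all add: sets)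
  have limit_Ga: "proj l u (xs - \<tau> *\<^sub>R G xs) $ i = xs $ i" if "i \<in> Gu \<union> Gl" for i
    using limit_Gamma[OF lim dlim dir, of i] that by (simp add: sets)
  have limit_Gu: "xs $ i = u $ i" "G xs $ i \<le> 0" if "i \<in> Gu" for i
    using limit_Gamma_u[OF lim dlim dir, of i] that by (simp_all add: sets)
  have limit_Gl: "xs $ i = - (l $ i)" "0 \<le> G xs $ i" if "i \<in> Gl" for i
    using limit_Gamma_l[OF lim dlim dir, of i] that by (simp_all add: sets)
  have xs_out: "xs $ i = 0" if "i \<notin> I_inf" for i
  proof -
    have "\<forall>\<^sub>F t in sequentially. x (r t) $ i = 0"
      using late by eventually_elim (rule zero[OF _ that])
    then have "(\<lambda>t. x (r t) $ i) \<longlonglongrightarrow> 0"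
      by (rule tendsto_eventually)
    then show ?thesis
      using LIMSEQ_unique tendsto_vec_nth[OF lim] by blast
  qed
  \<comment> \<open>On \<open>Th0\<close> the threshold keeps the entry away from 0; on
    \<open>Gu\<close> and \<open>Gl\<close> it equals a nonzero bound.\<close>
  have xs_in: "xs $ i \<noteq> 0" if i: "i \<in> I_inf" for i
    using i limit_Th(2)[of i] limit_Gu(1)[of i] limit_Gl(1)[of i] pos[of i] tl
    unfolding I_eq by auto
  have xs_box: "xs \<in> Omega l u"
    using closed_sequentially[OF closed_cbox _ lim] box by blast

  have "xs \<noteq> 0"
  proof
    assume "xs = 0"
    then have "I_inf = {}"
      using xs_in by auto
    then have "x (Suc K) = 0" "I (x (Suc K)) = {}"
      using zero[of "Suc K"] K[of "Suc K"] by (auto simp: vec_eq_iff)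
    then have I0: "I 0 = {}"
      by simp
    obtain i where i: "G 0 $ i \<noteq> 0"
      using grad0 by (auto simp: vec_eq_iff)
    \<comment> \<open>The bound on \<open>lam\<close> means that the gradient step from 0 reaches
      the threshold in every coordinate with nonzero gradient; such a coordinate lies in
      \<open>I 0\<close> whether or not the step leaves the box there.\<close>
    have "lam_upper G \<tau> \<le> \<tau> / 2 * \<bar>G 0 $ i\<bar>\<^sup>2"
      unfolding lam_upper_def using i by (intro Min_le) auto
    then have "2 * \<tau> * lam \<le> 2 * \<tau> * (\<tau> / 2 * \<bar>G 0 $ i\<bar>\<^sup>2)"
      using lam(2) \<tau>(1) by (intro mult_left_mono) auto
    also have "\<dots> = (\<tau> * G 0 $ i)\<^sup>2"
      by (simp add: power2_eq_square)
    finally have "sqrt (2 * \<tau> * lam) \<le> \<bar>\<tau> * G 0 $ i\<bar>"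
      by (metis real_sqrt_le_mono real_sqrt_abs)
    then have "i \<in> I 0"
      by (auto simp: Iset_def Theta_def Gamma_ul_def Gamma_u_def Gamma_l_def)
    with I0 show False
      by simp
  qed

  \<comment> \<open>Here \<open>t\<close> may differ from \<open>\<tau>\<close>: the sign conditions
    concern only the gradient at \<open>xs\<close> and carry over, while both size conditions come
    from the bound on \<open>t\<close>.\<close>
  have stationary: "stationary_point l u lam G t xs"
    if t: "0 < t" "t < tau_star_bound l u lam G \<sigma> \<beta> \<delta> L xs" for t
  proof (rule stationary_pointI[OF xs_box t(1) lam(1)])
    fix i
    have b: "1 \<le> b_const G xs" "t < 2 * lam / (b_const G xs)\<^sup>2"
      using t(2) by (auto simp: tau_star_bound_def b_const_def)
    show "(t * G xs $ i)\<^sup>2 \<le> 2 * t * lam" if "xs $ i = 0"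
    proof -
      have "\<bar>G xs $ i\<bar> \<le> b_const G xs"
        unfolding b_const_def using that by (intro Max_ge) (auto simp: supp_def)
      then have "(G xs $ i)\<^sup>2 \<le> (b_const G xs)\<^sup>2"
        using b(1) by (simp add: abs_le_square_iff[symmetric])
      then have "t * (G xs $ i)\<^sup>2 \<le> t * (b_const G xs)\<^sup>2"
        using t(1) by simp
      also have "\<dots> \<le> 2 * lam"
        using b by (simp add: field_simps)
      finally have "t * (t * (G xs $ i)\<^sup>2) \<le> t * (2 * lam)"
        using t(1) by (intro mult_left_mono) auto
      then show ?thesis
        by (simp add: power2_eq_square algebra_simps)
    qed
    show "2 * t * lam \<le> (xs $ i)\<^sup>2" if "xs $ i \<noteq> 0"
    proof -
      have "t < \<bar>xs $ i\<bar>\<^sup>2 / (2 * lam)"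
        using t(2) that by (auto simp: tau_star_bound_def supp_def)
      then show ?thesis
        using lam(1) by (simp add: field_simps)
    qed
    show "G xs $ i = 0 \<or> xs $ i = u $ i \<and> G xs $ i \<le> 0 \<or> xs $ i = - (l $ i) \<and> 0 \<le> G xs $ i"
      if "xs $ i \<noteq> 0"
    proof -
      have "i \<in> Th0 \<union> (Gu \<union> Gl)"
        using xs_out that unfolding I_eq[symmetric] by blast
      then show ?thesis
        using limit_Th limit_Gu limit_Gl by blast
    qed
  qed

  have "bounded (range x)"
    using box by (intro bounded_subset[OF bounded_cbox]) auto
  then have isolated: "xs isolated_in limit_points x \<Longrightarrow> x \<longlonglongrightarrow> xs"
    using isolated_limit_point_imp_tendsto[OF _ _ dist0] by blast

  show ?thesis
  proof (intro conjI allI impI ballI)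
    show "\<exists>(r :: nat \<Rightarrow> nat) Theta_inf Gamma_inf Gamma_u_inf Gamma_l_inf.
        strict_mono r \<and> (x \<circ> r) \<longlonglongrightarrow> xs \<and>
        (\<forall>\<^sub>F t in sequentially. Th (x (r t)) = Theta_inf) \<and>
        (\<forall>\<^sub>F t in sequentially. Ga (x (r t)) = Gamma_inf) \<and>
        (\<forall>\<^sub>F t in sequentially. Gamma_u u G \<tau> (x (r t)) = Gamma_u_inf) \<and>
        (\<forall>\<^sub>F t in sequentially. Gamma_l l G \<tau> (x (r t)) = Gamma_l_inf) \<and>
        I_inf = Theta_inf \<union> Gamma_inf \<and>
        (\<forall>i\<in>Theta_inf. G xs $ i = 0) \<and>
        (\<forall>i\<in>Gamma_inf. proj l u (xs - \<tau> *\<^sub>R G xs) $ i - xs $ i = 0) \<and>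
        (\<forall>i\<in>Gamma_u_inf. xs $ i = u $ i) \<and>
        (\<forall>i\<in>Gamma_l_inf. xs $ i = - (l $ i))"
      using r lim limit_Th(1) limit_Ga limit_Gu(1) limit_Gl(1)
      by (intro exI[of _ r] exI[of _ Th0] exI[of _ "Gu \<union> Gl"] exI[of _ Gu] exI[of _ Gl])
        (simp add: sets I_eq o_def)
  qed (use xs_out \<open>xs \<noteq> 0\<close> xs_box stationary isolated in \<open>auto simp: supp_def\<close>)
qed

end
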